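(* Assume $\min\{q_1,q_2,q_S\}>0$ with $q_1+q_2+q_S=1$. For $\gamma>0$ let $Y_{1,\gamma}\in[Y_L,Y_F]$ be such that $P_{2,\gamma}(Y_{1,\gamma})=1$, and let $Y_{2,\gamma}\in[Y_L,Y_F]$ be such that $P_{1,\gamma}(Y_{2,\gamma})=1$. Then for $i=1,2$, $Y_{i,\gamma}$ is increasing in $\gamma$ and $$\lim_{\gamma\uparrow\infty}Y_{i,\gamma}=Y_F.$$
   Context: Constants: $r\in\mathbb{R}$, $\eta>0$, $\delta>0$, $K>0$, $0<D_2<D_1$; $$\beta:=\Big(\tfrac12-\tfrac{r-\delta}{\eta^2}\Big)+\sqrt{\Big(\tfrac12-\tfrac{r-\delta}{\eta^2}\Big)^2+\tfrac{2r}{\eta^2}}>1,\qquad Y_F:=\frac{\delta K\beta}{D_2(\beta-1)}.$$ For $y>0$: $F(y)=\frac{K}{\beta-1}(y/Y_F)^\beta$ if $y\le Y_F$, $F(y)=\frac{D_2y}{\delta}-K$ if $y>Y_F$; $L(y)=\frac{D_1y}{\delta}-\frac{D_1-D_2}{D_2}\frac{K\beta}{\beta-1}(y/Y_F)^\beta-K$ if $y<Y_F$, $L(y)=\frac{D_2y}{\delta}-K$ if $y\ge Y_F$; $S(y)=\frac{D_2y}{\delta}-K$. $Y_L$ is the unique point of $(0,Y_F)$ such that $S<L<F$ for $y<Y_L$, $S<L=F$ at $Y_L$, $S<F<L$ on $(Y_L,Y_F)$; and $S=F=L$ for $y\ge Y_F$. Utility $U(x)=-\exp(-\gamma x)$ with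 $\gamma>0$; $l:=U(L)$, $f:=U(F)$, $s:=U(S)$ (depending on $\gamma$). For $y\in[Y_L,Y_F)$, $$P_{i,\gamma}(y):=\frac{l(y)-f(y)}{q_i(l(y)-f(y))+q_S(l(y)-s(y))},\quad i=1,2,$$ extended to $y=Y_F$ by its left limit $1/(q_i+q_S)$. *)

theory Defs
  imports "HOL-Analysis.Analysis"
begin

definition beta :: "real \<Rightarrow> real \<Rightarrow> real \<Rightarrow> real" where
  "beta r \<eta> \<delta> =
     (1/2 - (r - \<delta>) / \<eta>\<^sup>2) + sqrt ((1/2 - (r - \<delta>) / \<eta>\<^sup>2)\<^sup>2 + 2 * r / \<eta>\<^sup>2)"

definition Y_F :: "real \<Rightarrow> real \<Rightarrow> real \<Rightarrow> real \<Rightarrow> real \<Rightarrow> real" where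
  "Y_F r \<eta> \<delta> K D2 = \<delta> * K * beta r \<eta> \<delta> / (D2 * (beta r \<eta> \<delta> - 1))"

definition follower :: "real \<Rightarrow> real \<Rightarrow> real \<Rightarrow> real \<Rightarrow> real \<Rightarrow> real \<Rightarrow> real" where
  "follower r \<eta> \<delta> K D2 y =
     (if y \<le> Y_F r \<eta> \<delta> K D2
      then K / (beta r \<eta> \<delta> - 1) * (y / Y_F r \<eta> \<delta> K D2) powr beta r \<eta> \<delta>
      else D2 * y / \<delta> - K)"

definition leader :: "real \<Rightarrow> real \<Rightarrow> real \<Rightarrow> real \<Rightarrow> real \<Rightarrow> real \<Rightarrow> real \<Rightarrow> real" where
  "leader r \<eta> \<delta> K D1 D2 y =
     (if y < Y_F r \<eta> \<delta> K D2
      then D1 * y / \<delta>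
           - (D1 - D2) / D2 * (K * beta r \<eta> \<delta> / (beta r \<eta> \<delta> - 1))
             * (y / Y_F r \<eta> \<delta> K D2) powr beta r \<eta> \<delta>
           - K
      else D2 * y / \<delta> - K)"

definition simultaneous :: "real \<Rightarrow> real \<Rightarrow> real \<Rightarrow> real \<Rightarrow> real" where
  "simultaneous \<delta> K D2 y = D2 * y / \<delta> - K"

definition is_Y_L :: "real \<Rightarrow> real \<Rightarrow> real \<Rightarrow> real \<Rightarrow> real \<Rightarrow> real \<Rightarrow> real \<Rightarrow> bool" where
  "is_Y_L r \<eta> \<delta> K D1 D2 c \<longleftrightarrow>
     (let F = follower r \<eta> \<delta> K D2; L = leader r \<eta> \<delta> K D1 D2;
          S = simultaneous \<delta> K D2; YF = Y_F r \<eta> \<delta> K D2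
      in c \<in> {0<..<YF}
       \<and> (\<forall>y\<in>{0<..<c}. S y < L y \<and> L y < F y)
       \<and> S c < L c \<and> L c = F c
       \<and> (\<forall>y\<in>{c<..<YF}. S y < F y \<and> F y < L y))"

text \<open>The description operator below is justified by \<open>ex1_Y_L\<close>.\<close>

definition Y_L :: "real \<Rightarrow> real \<Rightarrow> real \<Rightarrow> real \<Rightarrow> real \<Rightarrow> real \<Rightarrow> real" where
  "Y_L r \<eta> \<delta> K D1 D2 = (THE c. is_Y_L r \<eta> \<delta> K D1 D2 c)"

definition util :: "real \<Rightarrow> real \<Rightarrow> real" where
  "util \<gamma> x = - exp (- \<gamma> * x)"

definition P_raw ::
  "real \<Rightarrow> real \<Rightarrow> real \<Rightarrow> real \<Rightarrow> real \<Rightarrow> real \<Rightarrow> real \<Rightarrow> real \<Rightarrow> real \<Rightarrow> real \<Rightarrow> real" where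
  "P_raw r \<eta> \<delta> K D1 D2 q qS \<gamma> y =
     (let l = util \<gamma> (leader r \<eta> \<delta> K D1 D2 y);
          f = util \<gamma> (follower r \<eta> \<delta> K D2 y);
          s = util \<gamma> (simultaneous \<delta> K D2 y)
      in (l - f) / (q * (l - f) + qS * (l - s)))"

text \<open>At \<open>Y_F\<close> the quotient is \<open>0 / 0\<close>; the value used there is its left limit,
  see \<open>P_raw_tendsto_left\<close>.\<close>

definition P ::
  "real \<Rightarrow> real \<Rightarrow> real \<Rightarrow> real \<Rightarrow> real \<Rightarrow> real \<Rightarrow> real \<Rightarrow> real \<Rightarrow> real \<Rightarrow> real \<Rightarrow> real" where
  "P r \<eta> \<delta> K D1 D2 q qS \<gamma> y =
     (if y = Y_F r \<eta> \<delta> K D2 then 1 / (q + qS) else P_raw r \<eta> \<delta> K D1 D2 q qS \<gamma> y)"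

lemma beta_gt_1:
  assumes "\<eta> > 0" "\<delta> > 0"
  shows "beta r \<eta> \<delta> > 1"
proof -
  define a where "a = 1/2 - (r - \<delta>) / \<eta>\<^sup>2"
  have eq: "a\<^sup>2 + 2 * r / \<eta>\<^sup>2 = (1 - a)\<^sup>2 + 2 * \<delta> / \<eta>\<^sup>2"
    using assms by (simp add: a_def power2_eq_square field_simps)
  have "(1 - a)\<^sup>2 < a\<^sup>2 + 2 * r / \<eta>\<^sup>2"
    unfolding eq using assms by simp
  hence "sqrt ((1 - a)\<^sup>2) < sqrt (a\<^sup>2 + 2 * r / \<eta>\<^sup>2)"
    by (rule real_sqrt_less_mono)
  hence "1 - a < sqrt (a\<^sup>2 + 2 * r / \<eta>\<^sup>2)"
    by simp
  thus ?thesis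
    unfolding beta_def a_def[symmetric] by simp
qed

lemma Y_F_pos:
  assumes "\<eta> > 0" "\<delta> > 0" "K > 0" "D2 > 0"
  shows "Y_F r \<eta> \<delta> K D2 > 0"
  using beta_gt_1[of \<eta> \<delta> r] assms by (simp add: Y_F_def)

lemma ex1_Y_L:
  assumes "\<eta> > 0" "\<delta> > 0" "K > 0" "0 < D2" "D2 < D1"
  shows "\<exists>!c. is_Y_L r \<eta> \<delta> K D1 D2 c"
proof -
  define b where "b = beta r \<eta> \<delta>"
  define Y where "Y = Y_F r \<eta> \<delta> K D2"
  have b: "b > 1" using beta_gt_1 assms by (simp add: b_def)
  have Y: "Y > 0" using Y_F_pos assms by (simp add: Y_def)
  have K_eq: "K * b / (b - 1) = D2 * Y / \<delta>" "K / (b - 1) = D2 * Y / (\<delta> * b)"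
    using assms b by (simp_all add: Y_def Y_F_def b_def[symmetric] field_simps)
  have K_eq3: "K = D2 * Y / \<delta> - D2 * Y / (\<delta> * b)"
  proof -
    have "K = K / (b - 1) * (b - 1)" using b by simp
    thus ?thesis using b assms unfolding K_eq(2) by (simp add: field_simps)
  qed
  define F where "F = follower r \<eta> \<delta> K D2"
  define L where "L = leader r \<eta> \<delta> K D1 D2"
  define S where "S = simultaneous \<delta> K D2"
  have F: "F y = D2 * Y / (\<delta> * b) * (y / Y) powr b" if "y < Y" for y
    using that by (simp add: F_def follower_def Y_def[symmetric] b_def[symmetric] K_eq(2))
  have L: "L y = D1 * y / \<delta> - (D1 - D2) * Y / \<delta> * (y / Y) powr b - K" if "y < Y" for y
    using that assms
    by (simp add: L_def leader_def Y_def[symmetric] b_def[symmetric] K_eq(1))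
  have S: "S y = D2 * y / \<delta> - K" for y
    by (simp add: S_def simultaneous_def)
  define C where "C = (D1 - D2) * Y / \<delta> + D2 * Y / (\<delta> * b)"
  have C: "C > 0" using assms b Y by (simp add: C_def add_pos_pos)
  define g where "g = (\<lambda>y. D1 * y / \<delta> - C * (y / Y) powr b - K)"
  define g' where "g' = (\<lambda>y. D1 / \<delta> - C * (b / Y) * (y / Y) powr (b - 1))"
  have LF: "L y - F y = g y" if "y < Y" for y
    using F[OF that] L[OF that] by (simp add: g_def C_def ring_distribs)
  have der: "(g has_real_derivative g' y) (at y)" if "y > 0" for y
    unfolding g_def g'_def using that Y assms
    by (auto intro!: derivative_eq_intros simp: powr_diff field_simps)
  have g'_less: "g' z < g' y" if "0 < y" "y < z" for y z
  proof -
    have "(y / Y) powr (b - 1) < (z / Y) powr (b - 1)"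
      using that Y b by (intro powr_less_mono2) (auto simp: divide_strict_right_mono)
    moreover have "C * (b / Y) > 0" using C b Y by simp
    ultimately have "C * (b / Y) * (y / Y) powr (b - 1) < C * (b / Y) * (z / Y) powr (b - 1)"
      by (rule mult_strict_left_mono)
    thus ?thesis by (simp add: g'_def)
  qed
  have gY: "g Y = 0"
    using Y assms b by (simp add: g_def C_def K_eq3 field_simps)
  have g'Y: "g' Y < 0"
  proof -
    have "g' Y = (D1 - D2) * (1 - b) / \<delta>"
      using Y assms b by (simp add: g'_def C_def field_simps)
    also have "\<dots> < 0"
      using assms b by (simp add: divide_less_0_iff mult_less_0_iff)
    finally show ?thesis .
  qed
  obtain d where d: "d > 0" "\<And>h. h > 0 \<Longrightarrow> h < d \<Longrightarrow> g Y < g (Y - h)"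
    using DERIV_neg_dec_left[OF der[OF Y] g'Y] by auto
  define w where "w = Y - min (d / 2) (Y / 2)"
  have w: "0 < w" "w < Y" using d(1) Y by (auto simp: w_def min_def)
  have gw: "g w > 0" using d(2)[of "min (d / 2) (Y / 2)"] d(1) Y gY by (simp add: w_def min_def)
  have g0: "g 0 < 0" using assms by (simp add: g_def)
  have "continuous_on {0..w} (\<lambda>y. (y / Y) powr b)"
    using b Y by (intro continuous_on_powr' continuous_intros) auto
  hence "continuous_on {0..w} g"
    unfolding g_def using assms
    by (intro continuous_on_diff continuous_on_divide continuous_on_mult
        continuous_on_const continuous_on_id) auto
  then obtain c where c: "0 \<le> c" "c \<le> w" "g c = 0"
    using IVT'[of g 0 0 w] g0 gw w by auto
  have "c \<noteq> 0" using g0 c by auto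
  hence c': "0 < c" "c < Y" using c w by auto
  obtain \<xi> where \<xi>: "c < \<xi>" "\<xi> < Y" "g' \<xi> = 0"
  proof -
    have "\<exists>z>c. z < Y \<and> g Y - g c = (Y - c) * g' z"
      using c' by (intro MVT2) (auto intro!: der)
    thus ?thesis using that gY c c' by auto
  qed
  have inc: "g y < g z" if "0 < y" "y < z" "z \<le> \<xi>" for y z
  proof -
    have "\<exists>x>y. x < z \<and> g z - g y = (z - y) * g' x"
      using that by (intro MVT2) (auto intro!: der)
    then obtain x where x: "y < x" "x < z" "g z - g y = (z - y) * g' x" by auto
    have "g' x > 0" using g'_less[of x \<xi>] x that \<xi> by simp
    hence "(z - y) * g' x > 0" using that by simp
    thus ?thesis using x by simp
  qed
  have dec: "g z < g y" if "\<xi> \<le> y" "y < z" for y z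
  proof -
    have "\<exists>x>y. x < z \<and> g z - g y = (z - y) * g' x"
      using that \<xi> c' by (intro MVT2) (auto intro!: der)
    then obtain x where x: "y < x" "x < z" "g z - g y = (z - y) * g' x" by auto
    have "g' x < 0" using g'_less[of \<xi> x] x that \<xi> c' by simp
    hence "(z - y) * g' x < 0" using that by (simp add: mult_less_0_iff)
    thus ?thesis using x by simp
  qed
  have neg: "g y < 0" if "0 < y" "y < c" for y
    using inc[of y c] that c \<xi> by simp
  have pos: "g y > 0" if "c < y" "y < Y" for y
    using inc[of c y] dec[of y Y] that c c' \<xi> gY by (cases "y \<le> \<xi>") auto
  have SL: "S y < L y" if "0 < y" "y < Y" for y
  proof -
    have "(y / Y) powr b < (y / Y) powr 1"
      using that Y b by (intro powr_less_mono') auto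
    hence "Y * (y / Y) powr b < y" using that Y by (simp add: field_simps)
    hence "(D1 - D2) / \<delta> * (Y * (y / Y) powr b) < (D1 - D2) / \<delta> * y"
      using assms by (intro mult_strict_left_mono) auto
    thus ?thesis using that by (simp add: S L diff_divide_distrib ring_distribs)
  qed
  have SF: "S y < F y" if y: "0 < y" "y < Y" for y
  proof -
    define h where "h = (\<lambda>y. D2 * Y / (\<delta> * b) * (y / Y) powr b - (D2 * y / \<delta> - K))"
    have "\<exists>x>y. x < Y \<and> h Y - h y = (Y - y) * (D2 / \<delta> * ((x / Y) powr (b - 1) - 1))"
      unfolding h_def using y Y b assms
      by (intro MVT2) (auto intro!: derivative_eq_intros simp: powr_diff field_simps)
    then obtain x where x: "y < x" "x < Y"
      "h Y - h y = (Y - y) * (D2 / \<delta> * ((x / Y) powr (b - 1) - 1))" by auto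
    have "(x / Y) powr (b - 1) < 1"
      using powr_less_mono2[of "b - 1" "x / Y" 1] x y Y b by simp
    hence "(Y - y) * (D2 / \<delta> * ((x / Y) powr (b - 1) - 1)) < 0"
      using x y assms by (intro mult_pos_neg) auto
    moreover have "h Y = 0" using Y by (simp add: h_def K_eq3)
    ultimately show ?thesis using x y by (simp add: h_def S F)
  qed
  have "is_Y_L r \<eta> \<delta> K D1 D2 c"
    unfolding is_Y_L_def Let_def F_def[symmetric] L_def[symmetric] S_def[symmetric]
      Y_def[symmetric]
  proof (intro conjI ballI)
    fix y assume "y \<in> {0<..<c}"
    thus "S y < L y" "L y < F y" using SL[of y] neg[of y] LF[of y] c' by auto
  next
    fix y assume "y \<in> {c<..<Y}"
    thus "S y < F y" "F y < L y" using SF[of y] pos[of y] LF[of y] c' by auto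
  qed (use c c' SL[of c] LF[of c] in auto)
  moreover have "z = c" if "is_Y_L r \<eta> \<delta> K D1 D2 z" for z
  proof -
    have z: "0 < z" "z < Y" "L z = F z"
      using that unfolding is_Y_L_def Let_def F_def L_def Y_def by auto
    hence "g z = 0" using LF[of z] by simp
    thus ?thesis using neg[of z] pos[of z] z by (cases z c rule: linorder_cases) auto
  qed
  ultimately show ?thesis by blast
qed

lemma P_raw_tendsto_left:
  assumes "\<eta> > 0" "\<delta> > 0" "K > 0" "0 < D2" "D2 < D1" "\<gamma> > 0" "q > 0" "qS > 0"
  shows "(P_raw r \<eta> \<delta> K D1 D2 q qS \<gamma> \<longlongrightarrow> 1 / (q + qS)) (at_left (Y_F r \<eta> \<delta> K D2))"
proof -
  define b where "b = beta r \<eta> \<delta>"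
  define Y where "Y = Y_F r \<eta> \<delta> K D2"
  have b: "b > 1" using beta_gt_1 assms by (simp add: b_def)
  have Y: "Y > 0" using Y_F_pos assms by (simp add: Y_def)
  have K_eq: "K * b / (b - 1) = D2 * Y / \<delta>" "K / (b - 1) = D2 * Y / (\<delta> * b)"
    using assms b by (simp_all add: Y_def Y_F_def b_def[symmetric] field_simps)
  have K_eq3: "K = D2 * Y / \<delta> - D2 * Y / (\<delta> * b)"
  proof -
    have "K = K / (b - 1) * (b - 1)" using b by simp
    thus ?thesis using b assms unfolding K_eq(2) by (simp add: field_simps)
  qed
  define F where "F = (\<lambda>y. D2 * Y / (\<delta> * b) * (y / Y) powr b)"
  define L where "L = (\<lambda>y. D1 * y / \<delta> - (D1 - D2) * Y / \<delta> * (y / Y) powr b - K)"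
  define S where "S = (\<lambda>y. D2 * y / \<delta> - K)"
  define e where "e = \<gamma> * exp (- \<gamma> * S Y)"
  have e: "e > 0" using assms by (simp add: e_def)
  have FY: "F Y = S Y" and LY: "L Y = S Y"
    using Y assms by (simp_all add: F_def L_def S_def K_eq3 field_simps)
  have dS: "(S has_real_derivative D2 / \<delta>) (at Y)"
    unfolding S_def using assms by (auto intro!: derivative_eq_intros)
  have dF: "(F has_real_derivative D2 / \<delta>) (at Y)"
    unfolding F_def using assms b Y
    by (auto intro!: derivative_eq_intros simp: field_simps)
  have dL: "(L has_real_derivative (D1 - (D1 - D2) * b) / \<delta>) (at Y)"
    unfolding L_def using assms b Y
    by (auto intro!: derivative_eq_intros simp: field_simps)
  define d where "d = e * ((D1 - (D1 - D2) * b) / \<delta> - D2 / \<delta>)"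
  have d: "d \<noteq> 0"
  proof -
    have "(D1 - (D1 - D2) * b) / \<delta> - D2 / \<delta> = (D1 - D2) * (1 - b) / \<delta>"
      using assms by (simp add: field_simps)
    thus ?thesis using e assms b by (simp add: d_def)
  qed
  have dU: "((\<lambda>y. util \<gamma> (G y)) has_real_derivative e * G') (at Y)"
    if "(G has_real_derivative G') (at Y)" "G Y = S Y" for G G'
    unfolding util_def e_def
    by (rule derivative_eq_intros that refl | simp add: that)+
  have lim: "((\<lambda>y. (util \<gamma> (L y) - util \<gamma> (G y)) / (y - Y)) \<longlongrightarrow> d) (at_left Y)"
    if "(G has_real_derivative D2 / \<delta>) (at Y)" "G Y = S Y" for G
  proof -
    have "((\<lambda>y. util \<gamma> (L y) - util \<gamma> (G y)) has_real_derivative d) (at Y)"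
      unfolding d_def right_diff_distrib by (intro DERIV_diff dU dL LY that)
    hence "((\<lambda>y. util \<gamma> (L y) - util \<gamma> (G y)) has_real_derivative d) (at Y within {..<Y})"
      by (rule has_field_derivative_at_within)
    thus ?thesis by (simp add: has_field_derivative_iff LY that(2))
  qed
  define N where "N = (\<lambda>y. (util \<gamma> (L y) - util \<gamma> (F y)) / (y - Y))"
  define M where "M = (\<lambda>y. (util \<gamma> (L y) - util \<gamma> (S y)) / (y - Y))"
  have "((\<lambda>y. N y / (q * N y + qS * M y)) \<longlongrightarrow> d / (q * d + qS * d)) (at_left Y)"
    unfolding N_def M_def
  proof (intro tendsto_intros lim dF dS FY refl)
    have "q + qS \<noteq> 0" using assms by linarith
    thus "q * d + qS * d \<noteq> 0" using d by (simp flip: distrib_right)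
  qed
  moreover have "d / (q * d + qS * d) = 1 / (q + qS)"
    using d by (simp flip: distrib_right)
  moreover have "\<forall>\<^sub>F y in at_left Y. N y / (q * N y + qS * M y) = P_raw r \<eta> \<delta> K D1 D2 q qS \<gamma> y"
    unfolding eventually_at_filter
  proof (intro always_eventually allI impI)
    fix y assume "y \<noteq> Y" "y \<in> {..<Y}"
    hence y: "y < Y" "y - Y \<noteq> 0" by auto
    have "follower r \<eta> \<delta> K D2 y = F y" "leader r \<eta> \<delta> K D1 D2 y = L y"
      "simultaneous \<delta> K D2 y = S y"
      using y assms
      by (simp_all add: follower_def leader_def simultaneous_def F_def L_def S_def
          Y_def[symmetric] b_def[symmetric] K_eq)
    moreover have "q * N y + qS * M y =
        (q * (util \<gamma> (L y) - util \<gamma> (F y)) + qS * (util \<gamma> (L y) - util \<gamma> (S y))) / (y - Y)"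
      by (simp add: N_def M_def add_divide_distrib)
    ultimately show "N y / (q * N y + qS * M y) = P_raw r \<eta> \<delta> K D1 D2 q qS \<gamma> y"
      using y by (simp add: P_raw_def Let_def N_def)
  qed
  ultimately show ?thesis
    unfolding Y_def[symmetric] by (auto elim: Lim_transform_eventually)
qed

end

theory Submission
  imports Defs
begin

text \<open>
  Put \<open>u = F - S\<close> and \<open>d = L - S\<close>. Dividing by \<open>exp (-\<gamma> S)\<close>, the equation \<open>P = 1\<close> reads
  \<open>H \<gamma> y = 1 - qS / (1 - q)\<close> with \<open>H \<gamma> y = (1 - exp (-\<gamma> u)) / (1 - exp (-\<gamma> d))\<close>.
  As \<open>0 < u < d\<close> between \<open>Y_L\<close> and \<open>Y_F\<close>, \<open>H\<close> is strictly increasing in \<open>\<gamma>\<close>, with limit \<open>1\<close>.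
  It is decreasing in \<open>y\<close>: the function \<open>u\<close> is convex, \<open>d\<close> is concave and both vanish at \<open>Y_F\<close>,
  so passing from \<open>y\<close> to \<open>z > y\<close> shrinks \<open>u\<close> at least, and \<open>d\<close> at most, by the factor
  \<open>(Y_F - z) / (Y_F - y) < 1\<close>, and shrinking both by the same factor amounts to shrinking \<open>\<gamma>\<close>.
\<close>

text \<open>Strict concavity of \<open>t powr p\<close>: by the mean value theorem the slope
  \<open>A\<close> over \<open>[z, 1]\<close> is smaller than the slope \<open>B\<close> over
  \<open>[x, z]\<close>, and the slope over \<open>[x, 1]\<close> is a weighted average of the
  two.\<close>

lemma powr_chord_slope_less:
  fixes p x z :: real
  assumes "0 < p" "p < 1" "0 < x" "x < z" "z < 1"
  shows "(1 - z powr p) / (1 - z) < (1 - x powr p) / (1 - x)"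
proof -
  have der: "((\<lambda>t. t powr p) has_real_derivative p * t powr (p - 1)) (at t)" if "t > 0" for t :: real
    using that by (rule has_real_derivative_powr)
  have "\<exists>\<xi>>z. \<xi> < 1 \<and> 1 powr p - z powr p = (1 - z) * (p * \<xi> powr (p - 1))"
    using assms by (intro MVT2 der) auto
  then obtain \<xi> where \<xi>: "z < \<xi>" "1 - z powr p = (1 - z) * (p * \<xi> powr (p - 1))"
    by auto
  have "\<exists>\<zeta>>x. \<zeta> < z \<and> z powr p - x powr p = (z - x) * (p * \<zeta> powr (p - 1))"
    using assms by (intro MVT2 der) auto
  then obtain \<zeta> where \<zeta>: "x < \<zeta>" "\<zeta> < z" "z powr p - x powr p = (z - x) * (p * \<zeta> powr (p - 1))"
    by auto
  define A where "A = p * \<xi> powr (p - 1)"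
  define B where "B = p * \<zeta> powr (p - 1)"
  have "\<xi> powr (p - 1) < \<zeta> powr (p - 1)"
    using \<xi> \<zeta> assms by (intro powr_less_mono2_neg) auto
  hence "A < B" using assms by (simp add: A_def B_def)
  hence "(z - x) * A < (z - x) * B" using assms by simp
  hence "(1 - x) * A < 1 - x powr p"
    using \<xi>(2) \<zeta>(3) by (simp add: A_def [symmetric] B_def [symmetric] algebra_simps)
  hence "A < (1 - x powr p) / (1 - x)"
    using assms by (simp add: field_simps)
  moreover have "(1 - z powr p) / (1 - z) = A"
    using \<xi>(2) assms by (simp add: A_def)
  ultimately show ?thesis by simp
qed

text \<open>With \<open>t = exp (- c * d)\<close> and \<open>p = u / d < 1\<close> the quotient is
  the chord slope \<open>(1 - t powr p) / (1 - t)\<close>, and \<open>t\<close> decreases when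
  \<open>c\<close> grows from \<open>a\<close> to \<open>b\<close>.\<close>

lemma one_minus_exp_quotient_less:
  fixes u d a b :: real
  assumes "0 < u" "u < d" "0 < a" "a < b"
  shows "(1 - exp (- a * u)) / (1 - exp (- a * d)) < (1 - exp (- b * u)) / (1 - exp (- b * d))"
proof -
  have "exp (- c * d) powr (u / d) = exp (- c * u)" for c
    using assms by (simp add: powr_def)
  moreover have "u / d < 1" "exp (- b * d) < exp (- a * d)" "exp (- a * d) < 1"
    using assms by auto
  ultimately show ?thesis
    using powr_chord_slope_less[of "u / d" "exp (- b * d)" "exp (- a * d)"] assms by simp
qed

lemma one_minus_exp_quotient_tendsto:
  fixes u d :: real
  assumes "0 < u" "0 < d"
  shows "((\<lambda>\<gamma>. (1 - exp (- \<gamma> * u)) / (1 - exp (- \<gamma> * d))) \<longlongrightarrow> 1) at_top"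
proof -
  have lim: "((\<lambda>\<gamma>. exp (- \<gamma> * v)) \<longlongrightarrow> 0) at_top" if "v > 0" for v :: real
  proof -
    have "filterlim (\<lambda>\<gamma>. \<gamma> * v) at_top at_top"
      using that by (intro filterlim_at_top_mult_tendsto_pos[OF tendsto_const] filterlim_ident) auto
    hence "filterlim (\<lambda>\<gamma>. - (\<gamma> * v)) at_bot at_top"
      by (simp add: filterlim_uminus_at_bot)
    thus ?thesis
      using filterlim_compose[OF exp_at_bot] by simp
  qed
  have "((\<lambda>\<gamma>. (1 - exp (- \<gamma> * u)) / (1 - exp (- \<gamma> * d))) \<longlongrightarrow> (1 - 0) / (1 - 0)) at_top"
    by (intro tendsto_intros lim assms) simp
  thus ?thesis by simp
qed

text \<open>Raising \<gamma> raises the quotient at a fixed point, so the point where it equals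
  \<open>c\<close> must move right to compensate. At each fixed \<open>y\<close> the quotient tends
  to 1, hence eventually exceeds \<open>c\<close>, which pushes \<open>Z \<gamma>\<close> past
  \<open>y\<close>.\<close>

lemma one_minus_exp_quotient_level:
  fixes u d Z :: "real \<Rightarrow> real" and A B c :: real
  assumes AB: "A < B" and c: "c < 1"
    and u: "\<And>y. y \<in> {A<..<B} \<Longrightarrow> 0 < u y" and ud: "\<And>y. y \<in> {A<..<B} \<Longrightarrow> u y < d y"
    and u_chord: "\<And>y z. A < y \<Longrightarrow> y < z \<Longrightarrow> z < B \<Longrightarrow> u z \<le> (B - z) / (B - y) * u y"
    and d_chord: "\<And>y z. A < y \<Longrightarrow> y < z \<Longrightarrow> z < B \<Longrightarrow> (B - z) / (B - y) * d y \<le> d z"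
    and Z: "\<And>\<gamma>. \<gamma> > 0 \<Longrightarrow> Z \<gamma> \<in> {A<..<B}"
    and level: "\<And>\<gamma>. \<gamma> > 0 \<Longrightarrow>
           (1 - exp (- \<gamma> * u (Z \<gamma>))) / (1 - exp (- \<gamma> * d (Z \<gamma>))) = c"
  shows "strict_mono_on {0<..} Z" and "(Z \<longlongrightarrow> B) at_top"
proof -
  define H where "H = (\<lambda>\<gamma> y. (1 - exp (- \<gamma> * u y)) / (1 - exp (- \<gamma> * d y)))"
  have H_y: "H \<gamma> z < H \<gamma> y" if "\<gamma> > 0" "A < y" "y < z" "z < B" for \<gamma> y z
  proof -
    define \<rho> where "\<rho> = (B - z) / (B - y)"
    have \<rho>: "0 < \<rho>" "\<rho> < 1" using that by (auto simp: \<rho>_def)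
    have pos: "0 < u y" "u y < d y" "0 < u z" "u z < d z"
      using u[of y] ud[of y] u[of z] ud[of z] that by auto
    have "\<gamma> * u z \<le> \<gamma> * (\<rho> * u y)" "\<gamma> * (\<rho> * d y) \<le> \<gamma> * d z"
      unfolding \<rho>_def using u_chord[of y z] d_chord[of y z] that
      by (intro mult_left_mono; simp)+
    moreover have "0 < \<gamma> * (\<rho> * d y)" "0 < \<gamma> * u z"
      using \<rho> pos that by auto
    \<comment> \<open>The numerator can only grow and the denominator only shrink, which leaves the
      quotient at \<open>y\<close> with parameter
      \<open>\<gamma> * \<rho> < \<gamma>\<close>.\<close>
    ultimately have "H \<gamma> z \<le> (1 - exp (- (\<gamma> * \<rho>) * u y)) / (1 - exp (- (\<gamma> * \<rho>) * d y))"
      unfolding H_def by (intro frac_le) (auto simp: mult.assoc)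
    also have "\<dots> < H \<gamma> y"
      unfolding H_def using pos \<rho> that by (intro one_minus_exp_quotient_less) auto
    finally show ?thesis .
  qed
  have HZ: "H \<gamma> (Z \<gamma>) = c" if "\<gamma> > 0" for \<gamma>
    using level[OF that] by (simp add: H_def)
  show "strict_mono_on {0<..} Z"
  proof (rule strict_mono_onI)
    fix \<gamma> \<gamma>' :: real
    assume *: "\<gamma> \<in> {0<..}" "\<gamma>' \<in> {0<..}" "\<gamma> < \<gamma>'"
    have less: "H \<gamma> (Z \<gamma>) < H \<gamma>' (Z \<gamma>)"
      unfolding H_def using * Z u ud by (intro one_minus_exp_quotient_less) auto
    show "Z \<gamma> < Z \<gamma>'"
    proof (rule ccontr)
      assume "\<not> Z \<gamma> < Z \<gamma>'"
      hence "H \<gamma>' (Z \<gamma>) \<le> H \<gamma>' (Z \<gamma>')"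
        using H_y[of \<gamma>' "Z \<gamma>'" "Z \<gamma>"] Z[of \<gamma>] Z[of \<gamma>'] * by (cases "Z \<gamma>" "Z \<gamma>'" rule: linorder_cases) auto
      thus False using less HZ[of \<gamma>] HZ[of \<gamma>'] * by simp
    qed
  qed
  show "(Z \<longlongrightarrow> B) at_top"
  proof (rule order_tendstoI)
    fix a assume "a < B"
    \<comment> \<open>The maximum keeps \<open>y\<close> inside the interval even if
      \<open>a\<close> lies to the left of \<open>A\<close>.\<close>
    define y where "y = (max a A + B) / 2"
    have y: "a < y" "y \<in> {A<..<B}" using \<open>a < B\<close> AB by (auto simp: y_def max_def)
    have "((\<lambda>\<gamma>. H \<gamma> y) \<longlongrightarrow> 1) at_top"
      unfolding H_def using u[OF y(2)] ud[OF y(2)] by (intro one_minus_exp_quotient_tendsto) auto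
    hence "\<forall>\<^sub>F \<gamma> in at_top. c < H \<gamma> y"
      using c by (rule order_tendstoD)
    with eventually_gt_at_top[of 0] show "\<forall>\<^sub>F \<gamma> in at_top. a < Z \<gamma>"
    proof eventually_elim
      case (elim \<gamma>)
      have "y \<le> Z \<gamma>"
      proof (rule ccontr)
        assume "\<not> y \<le> Z \<gamma>"
        hence "H \<gamma> y < H \<gamma> (Z \<gamma>)" using H_y[of \<gamma> "Z \<gamma>" y] Z[of \<gamma>] y elim by auto
        thus False using HZ[of \<gamma>] elim by simp
      qed
      thus ?case using y by simp
    qed
  next
    fix a assume "B < a"
    show "\<forall>\<^sub>F \<gamma> in at_top. Z \<gamma> < a"
      using eventually_gt_at_top[of 0]
    proof eventually_elim
      case (elim \<gamma>)
      thus ?case using Z[of \<gamma>] \<open>B < a\<close> by simp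
    qed
  qed
qed

text \<open>Convexity of \<open>t powr b\<close> between \<open>y / B\<close> and 1: the point
  \<open>z / B\<close> carries weight \<open>(B - z) / (B - y)\<close> on \<open>y / B\<close>, and
  the function equals 1 at 1.\<close>

lemma powr_chord_le:
  fixes b B y z :: real
  assumes "1 \<le> b" "0 < y" "y < z" "z < B"
  shows "(z / B) powr b \<le> (B - z) / (B - y) * (y / B) powr b + (1 - (B - z) / (B - y))"
proof -
  define \<rho> where "\<rho> = (B - z) / (B - y)"
  have \<rho>: "0 \<le> \<rho>" "\<rho> \<le> 1" using assms by (auto simp: \<rho>_def)
  have "\<rho> * (B - y) = B - z" using assms by (simp add: \<rho>_def)
  hence "z = \<rho> * y + (1 - \<rho>) * B" by (simp add: algebra_simps)
  hence z: "z / B = \<rho> * (y / B) + (1 - \<rho>) * 1" using assms by (simp add: field_simps)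
  have "convex_on {0<..} (\<lambda>t. t powr b)"
    using assms by (intro powr_convex) auto
  from convex_onD[OF this, of "1 - \<rho>" "y / B" 1] show ?thesis
    using \<rho> assms unfolding z \<rho>_def[symmetric] by simp
qed

text \<open>Below \<open>Y_F\<close> both differences are affine plus a multiple of
  \<open>(y / Y_F) powr beta\<close>, with positive coefficient for the follower (convex) and
  negative for the leader (concave). Since both vanish at \<open>Y_F\<close>, the factor \<rho>
  gives the value at \<open>z\<close> of the chord from \<open>y\<close> to
  \<open>Y_F\<close>.\<close>

lemma follower_leader_chords:
  assumes "\<eta> > 0" "\<delta> > 0" "K > 0" "0 < D2" "D2 < D1"
    and "0 < y" "y < z" "z < Y_F r \<eta> \<delta> K D2"
  defines "\<rho> \<equiv> (Y_F r \<eta> \<delta> K D2 - z) / (Y_F r \<eta> \<delta> K D2 - y)"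
  shows "follower r \<eta> \<delta> K D2 z - simultaneous \<delta> K D2 z
           \<le> \<rho> * (follower r \<eta> \<delta> K D2 y - simultaneous \<delta> K D2 y)" (is ?F)
    and "\<rho> * (leader r \<eta> \<delta> K D1 D2 y - simultaneous \<delta> K D2 y)
           \<le> leader r \<eta> \<delta> K D1 D2 z - simultaneous \<delta> K D2 z" (is ?L)
proof -
  define b where "b = beta r \<eta> \<delta>"
  define Y where "Y = Y_F r \<eta> \<delta> K D2"
  have b: "b > 1" using beta_gt_1 assms by (simp add: b_def)
  have yz: "0 < y" "y < z" "z < Y" using assms by (simp_all add: Y_def)
  hence y_less: "y < Y" by simp
  define w where "w = (\<lambda>y. (y / Y) powr b)"
  have w: "w z \<le> \<rho> * w y + (1 - \<rho>)"
    using powr_chord_le[of b y z Y] b yz by (simp add: w_def \<rho>_def Y_def)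
  have "\<rho> * (Y - y) = Y - z" using yz by (simp add: \<rho>_def Y_def[symmetric])
  hence z: "z = \<rho> * y + (1 - \<rho>) * Y" by (simp add: algebra_simps)
  define k where "k = K / (b - 1)"
  have k: "k > 0" using assms b by (simp add: k_def)
  have K: "K = k * (b - 1)" using b by (simp add: k_def)
  \<comment> \<open>The definition of \<open>Y_F\<close> read in terms of \<open>k\<close>; together
    with \<open>K = k * (b - 1)\<close> it makes the constant terms cancel in the follower
    estimate.\<close>
  have Y: "D2 * Y / \<delta> = k * b"
    using assms b by (simp add: Y_def Y_F_def b_def[symmetric] k_def field_simps)
  have F: "follower r \<eta> \<delta> K D2 x - simultaneous \<delta> K D2 x = k * w x - D2 / \<delta> * x + k * (b - 1)"
    if "x < Y" for x
    using that K by (simp add: follower_def simultaneous_def Y_def[symmetric] b_def[symmetric] w_def k_def)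
  have L: "leader r \<eta> \<delta> K D1 D2 x - simultaneous \<delta> K D2 x = (D1 - D2) / \<delta> * (x - Y * w x)"
    if "x < Y" for x
  proof -
    have "K * b / (b - 1) = D2 * Y / \<delta>"
      using Y by (simp add: k_def)
    thus ?thesis
      using that assms by (simp add: leader_def simultaneous_def Y_def[symmetric] b_def[symmetric] w_def
          diff_divide_distrib algebra_simps)
  qed
  have "k * w z \<le> k * (\<rho> * w y + (1 - \<rho>))" using w k by simp
  moreover have "D2 / \<delta> * z = \<rho> * (D2 / \<delta> * y) + (1 - \<rho>) * (k * b)"
    unfolding z Y[symmetric] by (simp add: algebra_simps diff_divide_distrib)
  ultimately show ?F
    unfolding F[OF yz(3)] F[OF y_less] by (simp add: algebra_simps)
  have "Y * w z \<le> Y * (\<rho> * w y + (1 - \<rho>))" using w yz by simp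
  hence "\<rho> * (y - Y * w y) \<le> z - Y * w z"
    using \<open>\<rho> * (Y - y) = Y - z\<close> by (simp add: algebra_simps)
  hence "(D1 - D2) / \<delta> * (\<rho> * (y - Y * w y)) \<le> (D1 - D2) / \<delta> * (z - Y * w z)"
    using assms by (intro mult_left_mono) auto
  thus ?L
    unfolding L[OF yz(3)] L[OF y_less] by (simp only: mult_ac)
qed

text \<open>Since \<open>l - f = (l - s) - (f - s)\<close>, the equation is linear in
  \<open>(f - s) / (l - s)\<close>, and the common factor \<open>exp (- \<gamma> * S)\<close>
  cancels from that ratio.\<close>

lemma P_raw_eq_1D:
  assumes "P_raw r \<eta> \<delta> K D1 D2 q qS \<gamma> y = 1" and "q < 1" and "\<gamma> > 0"
    and SL: "simultaneous \<delta> K D2 y < leader r \<eta> \<delta> K D1 D2 y"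
  shows "(1 - exp (- \<gamma> * (follower r \<eta> \<delta> K D2 y - simultaneous \<delta> K D2 y)))
       / (1 - exp (- \<gamma> * (leader r \<eta> \<delta> K D1 D2 y - simultaneous \<delta> K D2 y))) = 1 - qS / (1 - q)"
proof -
  define L where "L = leader r \<eta> \<delta> K D1 D2 y"
  define F where "F = follower r \<eta> \<delta> K D2 y"
  define S where "S = simultaneous \<delta> K D2 y"
  define l where "l = util \<gamma> L"
  define f where "f = util \<gamma> F"
  define s where "s = util \<gamma> S"
  have "(l - f) / (q * (l - f) + qS * (l - s)) = 1"
    using assms(1) by (simp add: P_raw_def Let_def l_def f_def s_def L_def F_def S_def)
  \<comment> \<open>A zero denominator would give the quotient the value 0 rather than 1.\<close>
  hence eq: "l - f = q * (l - f) + qS * (l - s)"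
    by (cases "q * (l - f) + qS * (l - s) = 0") (auto simp: divide_eq_1_iff)
  have "s < l" using SL \<open>\<gamma> > 0\<close> by (simp add: s_def l_def util_def S_def L_def)
  have *: "util \<gamma> x - s = exp (- \<gamma> * S) * (1 - exp (- \<gamma> * (x - S)))" for x
    by (simp add: util_def s_def algebra_simps flip: exp_add)
  have "(1 - exp (- \<gamma> * (F - S))) / (1 - exp (- \<gamma> * (L - S))) = (f - s) / (l - s)"
    unfolding f_def l_def * by simp
  also have "\<dots> = 1 - qS / (1 - q)"
    using eq \<open>s < l\<close> \<open>q < 1\<close> by (simp add: field_simps)
  finally show ?thesis by (simp add: L_def F_def S_def)
qed

text \<open>Treats both thresholds at once: \<open>q\<close> is \<open>q2\<close> for
  \<open>Y1\<close> and \<open>q1\<close> for \<open>Y2\<close>, and \<open>q + qS < 1\<close>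
  expresses that the remaining weight is positive.\<close>

lemma threshold_mono_tendsto:
  fixes r \<eta> \<delta> K D1 D2 q qS :: real and Z :: "real \<Rightarrow> real"
  assumes "\<eta> > 0" "\<delta> > 0" "K > 0" "0 < D2" "D2 < D1"
    and q: "q > 0" "qS > 0" "q + qS < 1"
    and Z: "\<And>\<gamma>. \<gamma> > 0 \<Longrightarrow>
           Z \<gamma> \<in> {Y_L r \<eta> \<delta> K D1 D2 .. Y_F r \<eta> \<delta> K D2} \<and> P r \<eta> \<delta> K D1 D2 q qS \<gamma> (Z \<gamma>) = 1"
  shows "strict_mono_on {0<..} Z" and "(Z \<longlongrightarrow> Y_F r \<eta> \<delta> K D2) at_top"
proof -
  define F where "F = follower r \<eta> \<delta> K D2"
  define L where "L = leader r \<eta> \<delta> K D1 D2"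
  define S where "S = simultaneous \<delta> K D2"
  define A where "A = Y_L r \<eta> \<delta> K D1 D2"
  define B where "B = Y_F r \<eta> \<delta> K D2"
  have "is_Y_L r \<eta> \<delta> K D1 D2 A"
    unfolding A_def Y_L_def by (rule theI'[OF ex1_Y_L]) fact+
  hence AB: "0 < A" "A < B" and LA: "L A = F A"
    and SFL: "\<And>y. y \<in> {A<..<B} \<Longrightarrow> S y < F y" "\<And>y. y \<in> {A<..<B} \<Longrightarrow> F y < L y"
    by (auto simp: is_Y_L_def Let_def F_def L_def S_def B_def)
  \<comment> \<open>Both endpoints are excluded: at \<open>Y_F\<close> the extended value
    \<open>1 / (q + qS)\<close> exceeds 1, and at \<open>Y_L\<close> the numerator vanishes because
    \<open>L = F\<close> there.\<close>
  have Z': "Z \<gamma> \<in> {A<..<B}" "P_raw r \<eta> \<delta> K D1 D2 q qS \<gamma> (Z \<gamma>) = 1" if "\<gamma> > 0" for \<gamma>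
  proof -
    have "Z \<gamma> \<noteq> B" using Z[OF that] q by (auto simp: P_def B_def divide_eq_1_iff)
    thus *: "P_raw r \<eta> \<delta> K D1 D2 q qS \<gamma> (Z \<gamma>) = 1"
      using Z[OF that] by (simp add: P_def B_def)
    have "P_raw r \<eta> \<delta> K D1 D2 q qS \<gamma> A = 0"
      using LA by (simp add: P_raw_def Let_def L_def F_def)
    hence "Z \<gamma> \<noteq> A" using * by auto
    thus "Z \<gamma> \<in> {A<..<B}"
      using Z[OF that] \<open>Z \<gamma> \<noteq> B\<close> by (auto simp: A_def B_def)
  qed
  have level: "(1 - exp (- \<gamma> * (F (Z \<gamma>) - S (Z \<gamma>)))) / (1 - exp (- \<gamma> * (L (Z \<gamma>) - S (Z \<gamma>))))
      = 1 - qS / (1 - q)" if "\<gamma> > 0" for \<gamma>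
    unfolding F_def L_def S_def
    using Z'[OF that] SFL[of "Z \<gamma>"] q that
    by (intro P_raw_eq_1D) (auto simp: L_def F_def S_def)
  have chords: "F z - S z \<le> (B - z) / (B - y) * (F y - S y)"
    "(B - z) / (B - y) * (L y - S y) \<le> L z - S z" if "A < y" "y < z" "z < B" for y z
    unfolding F_def L_def S_def B_def using assms(1-5) that AB
    by (intro follower_leader_chords; simp add: B_def)+
  have c: "1 - qS / (1 - q) < 1" using q by simp
  show "strict_mono_on {0<..} Z"
    by (rule one_minus_exp_quotient_level(1)[OF AB(2) c _ _ chords Z'(1) level])
      (use SFL in auto)
  show "(Z \<longlongrightarrow> Y_F r \<eta> \<delta> K D2) at_top"
    unfolding B_def[symmetric]
    by (rule one_minus_exp_quotient_level(2)[OF AB(2) c _ _ chords Z'(1) level])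
      (use SFL in auto)
qed

theorem proposition8:
  fixes r \<eta> \<delta> K D1 D2 q1 q2 qS :: real and Y1 Y2 :: "real \<Rightarrow> real"
  assumes "\<eta> > 0" and "\<delta> > 0" and "K > 0" and "0 < D2" and "D2 < D1"
    and "Min {q1, q2, qS} > 0" and "q1 + q2 + qS = 1"
    and "\<And>\<gamma>. \<gamma> > 0 \<Longrightarrow>
           Y1 \<gamma> \<in> {Y_L r \<eta> \<delta> K D1 D2 .. Y_F r \<eta> \<delta> K D2} \<and> P r \<eta> \<delta> K D1 D2 q2 qS \<gamma> (Y1 \<gamma>) = 1"
    and "\<And>\<gamma>. \<gamma> > 0 \<Longrightarrow>
           Y2 \<gamma> \<in> {Y_L r \<eta> \<delta> K D1 D2 .. Y_F r \<eta> \<delta> K D2} \<and> P r \<eta> \<delta> K D1 D2 q1 qS \<gamma> (Y2 \<gamma>) = 1"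
  shows "strict_mono_on {0<..} Y1 \<and> (Y1 \<longlongrightarrow> Y_F r \<eta> \<delta> K D2) at_top \<and>
         strict_mono_on {0<..} Y2 \<and> (Y2 \<longlongrightarrow> Y_F r \<eta> \<delta> K D2) at_top"
proof -
  have q: "q1 > 0" "q2 > 0" "qS > 0" "q2 + qS < 1" "q1 + qS < 1"
    using assms(6,7) by auto
  show ?thesis
    using threshold_mono_tendsto[OF assms(1-5) q(2,3,4) assms(8)]
      threshold_mono_tendsto[OF assms(1-5) q(1,3,5) assms(9)] by blast
qed

end
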